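(* Let $\mathbb{L}^3$ be $\mathbb{R}^3$ with coordinates $(x,y,z)$ and the metric $g=-2\,dx\,dy+dz^2$. Let $a_1,b_1,b_0\in\mathbb{R}$ with $a_1\neq0$, and let $\psi(y,z)=(u(y,z),y,z)$ with $$u(y,z)=a_1e^{-2y}-\frac{b_1^2}{2}y+b_1z+b_0 .$$ Then $\psi$ is space-like when $a_1>0$, and time-like when $a_1<0$. Moreover, if $\psi$ is inextensible, then $\psi$ is entire but not complete: when $a_1>0$ the induced Riemannian metric is not complete, and when $a_1<0$ the induced Lorentzian metric is not complete in each of the space-like, time-like and light-like senses.
   Context: A solution is inextensible if its domain $\Omega\subset\mathbb{R}^2$ is a maximal connected open set on which the formula for $u$ defines a smooth function. It is entire if $\Omega=\mathbb{R}^2$. It is space-like (respectively time-like) if the induced metric $\psi^*g$ on $\Omega$ is Riemannian (respectively Lorentzian). Completeness means geodesic completeness; a Lorentzian surface is not complete in the space-like (respectively time-like, light-like) sense if it admits an inextensible space-like (respectively time-like, light-like) geodesic whose affine parameter is not defined on all of $\mathbb{R}$. *)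

theory Defs
  imports "HOL-Analysis.Analysis"
begin

definition partial_deriv :: "'n::finite \<Rightarrow> (real^'n \<Rightarrow> real) \<Rightarrow> real^'n \<Rightarrow> real" where
  "partial_deriv i f p = frechet_derivative f (at p) (axis i 1)"

text \<open>The next two definitions are meant for open sets \<open>S\<close>.\<close>

primrec Ck_on :: "nat \<Rightarrow> (real^'n::finite \<Rightarrow> real) \<Rightarrow> (real^'n) set \<Rightarrow> bool" where
  "Ck_on 0 f S \<longleftrightarrow> continuous_on S f"
| "Ck_on (Suc k) f S \<longleftrightarrow>
     (\<forall>p\<in>S. f differentiable (at p)) \<and> (\<forall>i. Ck_on k (partial_deriv i f) S)"

definition smooth_fun_on :: "(real^'n::finite \<Rightarrow> real) \<Rightarrow> (real^'n) set \<Rightarrow> bool" where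
  "smooth_fun_on f S \<longleftrightarrow> (\<forall>k. Ck_on k f S)"


text \<open>A field of bilinear forms on (a part of) \<open>\<real>\<^sup>n\<close>: the arguments are the base point and two
  tangent vectors.\<close>

type_synonym 'n metric_field = "real^'n \<Rightarrow> real^'n \<Rightarrow> real^'n \<Rightarrow> real"

definition metric_comp :: "'n::finite metric_field \<Rightarrow> 'n \<Rightarrow> 'n \<Rightarrow> real^'n \<Rightarrow> real" where
  "metric_comp g i j p = g p (axis i 1) (axis j 1)"

definition smooth_sym_tensor_on :: "(real^'n::finite) set \<Rightarrow> 'n metric_field \<Rightarrow> bool" where
  "smooth_sym_tensor_on \<Omega> g \<longleftrightarrow>
     (\<forall>p\<in>\<Omega>. bilinear (g p) \<and> (\<forall>v w. g p v w = g p w v)) \<and>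
     (\<forall>i j. smooth_fun_on (metric_comp g i j) \<Omega>)"

definition riemannian_on :: "(real^'n::finite) set \<Rightarrow> 'n metric_field \<Rightarrow> bool" where
  "riemannian_on \<Omega> g \<longleftrightarrow> smooth_sym_tensor_on \<Omega> g \<and> (\<forall>p\<in>\<Omega>. \<forall>v. v \<noteq> 0 \<longrightarrow> g p v v > 0)"

text \<open>Signature (1,1): each tangent plane has a pseudo-orthonormal basis (linear independence
  of \<open>e\<close> and \<open>f\<close> is automatic).\<close>

definition lorentzian_on :: "(real^2) set \<Rightarrow> 2 metric_field \<Rightarrow> bool" where
  "lorentzian_on \<Omega> g \<longleftrightarrow> smooth_sym_tensor_on \<Omega> g \<and>
     (\<forall>p\<in>\<Omega>. \<exists>e f. g p e e = -1 \<and> g p f f = 1 \<and> g p e f = 0)"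


definition christoffel :: "'n::finite metric_field \<Rightarrow> 'n \<Rightarrow> 'n \<Rightarrow> 'n \<Rightarrow> real^'n \<Rightarrow> real" where
  "christoffel g k i j p =
     (1/2) * (\<Sum>l\<in>UNIV. matrix_inv (\<chi> r s. metric_comp g r s p) $ k $ l *
        (partial_deriv i (metric_comp g j l) p + partial_deriv j (metric_comp g i l) p
          - partial_deriv l (metric_comp g i j) p))"

text \<open>Affinely parametrised geodesics on open intervals. For a smooth nondegenerate metric,
  twice differentiable solutions of the geodesic equation are automatically smooth.\<close>

definition geodesic_on ::
  "(real^'n::finite) set \<Rightarrow> 'n metric_field \<Rightarrow> real set \<Rightarrow> (real \<Rightarrow> real^'n) \<Rightarrow> bool" where
  "geodesic_on \<Omega> g I \<gamma> \<longleftrightarrow> open I \<and> is_interval I \<and> I \<noteq> {} \<and> \<gamma> ` I \<subseteq> \<Omega> \<and>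
     (\<exists>\<gamma>' \<gamma>''. \<forall>t\<in>I.
        (\<gamma> has_vector_derivative \<gamma>' t) (at t) \<and>
        (\<gamma>' has_vector_derivative \<gamma>'' t) (at t) \<and>
        (\<forall>k. \<gamma>'' t $ k +
           (\<Sum>i\<in>UNIV. \<Sum>j\<in>UNIV. christoffel g k i j (\<gamma> t) * \<gamma>' t $ i * \<gamma>' t $ j) = 0))"

definition inextensible_geodesic ::
  "(real^'n::finite) set \<Rightarrow> 'n metric_field \<Rightarrow> real set \<Rightarrow> (real \<Rightarrow> real^'n) \<Rightarrow> bool" where
  "inextensible_geodesic \<Omega> g I \<gamma> \<longleftrightarrow> geodesic_on \<Omega> g I \<gamma> \<and>
     (\<forall>J \<delta>. geodesic_on \<Omega> g J \<delta> \<and> I \<subseteq> J \<and> (\<forall>t\<in>I. \<delta> t = \<gamma> t) \<longrightarrow> J = I)"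

definition geodesically_complete :: "(real^'n::finite) set \<Rightarrow> 'n metric_field \<Rightarrow> bool" where
  "geodesically_complete \<Omega> g \<longleftrightarrow> (\<forall>I \<gamma>. inextensible_geodesic \<Omega> g I \<gamma> \<longrightarrow> I = UNIV)"

definition spacelike_vec :: "'n::finite metric_field \<Rightarrow> real^'n \<Rightarrow> real^'n \<Rightarrow> bool" where
  "spacelike_vec g p v \<longleftrightarrow> g p v v > 0"

definition timelike_vec :: "'n::finite metric_field \<Rightarrow> real^'n \<Rightarrow> real^'n \<Rightarrow> bool" where
  "timelike_vec g p v \<longleftrightarrow> g p v v < 0"

definition lightlike_vec :: "'n::finite metric_field \<Rightarrow> real^'n \<Rightarrow> real^'n \<Rightarrow> bool" where
  "lightlike_vec g p v \<longleftrightarrow> g p v v = 0 \<and> v \<noteq> 0"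

text \<open>Completeness restricted to the geodesics all of whose velocities have the causal
  character \<open>C\<close>.\<close>

definition complete_in_sense ::
  "('n metric_field \<Rightarrow> real^'n \<Rightarrow> real^'n \<Rightarrow> bool) \<Rightarrow> (real^'n::finite) set \<Rightarrow> 'n metric_field \<Rightarrow> bool"
  where
  "complete_in_sense C \<Omega> g \<longleftrightarrow>
     (\<forall>I \<gamma>. inextensible_geodesic \<Omega> g I \<gamma> \<and>
        (\<forall>t\<in>I. C g (\<gamma> t) (vector_derivative \<gamma> (at t))) \<longrightarrow> I = UNIV)"


definition L3_metric :: "3 metric_field" where
  "L3_metric q v w = - (v$1 * w$2 + v$2 * w$1) + v$3 * w$3"

text \<open>Points of the parameter plane are \<open>p = (y, z)\<close>, i.e. \<open>y = p$1\<close> and \<open>z = p$2\<close>.\<close>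

definition graph_map :: "(real^2 \<Rightarrow> real) \<Rightarrow> real^2 \<Rightarrow> real^3" where
  "graph_map u p = vector [u p, p$1, p$2]"

definition pullback_metric ::
  "(real^'m::finite \<Rightarrow> real^'n::finite) \<Rightarrow> 'n metric_field \<Rightarrow> 'm metric_field" where
  "pullback_metric \<psi> g p v w =
     g (\<psi> p) (frechet_derivative \<psi> (at p) v) (frechet_derivative \<psi> (at p) w)"

definition spacelike_immersion_on :: "(real^2 \<Rightarrow> real^3) \<Rightarrow> (real^2) set \<Rightarrow> bool" where
  "spacelike_immersion_on \<psi> \<Omega> \<longleftrightarrow> riemannian_on \<Omega> (pullback_metric \<psi> L3_metric)"

definition timelike_immersion_on :: "(real^2 \<Rightarrow> real^3) \<Rightarrow> (real^2) set \<Rightarrow> bool" where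
  "timelike_immersion_on \<psi> \<Omega> \<longleftrightarrow> lorentzian_on \<Omega> (pullback_metric \<psi> L3_metric)"

definition graph_domain :: "(real^2 \<Rightarrow> real) \<Rightarrow> (real^2) set \<Rightarrow> bool" where
  "graph_domain u \<Omega> \<longleftrightarrow> open \<Omega> \<and> connected \<Omega> \<and> \<Omega> \<noteq> {} \<and> smooth_fun_on u \<Omega>"

definition inextensible_domain :: "(real^2 \<Rightarrow> real) \<Rightarrow> (real^2) set \<Rightarrow> bool" where
  "inextensible_domain u \<Omega> \<longleftrightarrow> graph_domain u \<Omega> \<and>
     (\<forall>\<Omega>'. graph_domain u \<Omega>' \<and> \<Omega> \<subseteq> \<Omega>' \<longrightarrow> \<Omega>' = \<Omega>)"

end

theory Submission
  imports Defs
begin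

text \<open>Substituting \<open>x = u(y, z)\<close>, so that \<open>dx = u\<^sub>y dy + b\<^sub>1 dz\<close>, into \<open>-2 dx dy + dz\<^sup>2\<close> gives the induced
  metric
  \<open>4 a\<^sub>1 exp (- 2 y) dy\<^sup>2 + (dz - b\<^sub>1 dy)\<^sup>2\<close>;
  the term \<open>- b\<^sub>1\<^sup>2 y / 2\<close> of \<open>u\<close> is exactly what completes the square. Hence the sign of \<open>a\<^sub>1\<close> decides
  the signature. Moreover, in the coordinates \<open>r = exp (- y) > 0\<close> and \<open>w = z - b\<^sub>1 y\<close> the metric is
  \<open>4 a\<^sub>1 dr\<^sup>2 + dw\<^sup>2\<close>: the entire graph is isometric to an open half-plane of a flat plane, and straight lines that
  leave the half-plane are incomplete geodesics.

  The lines used are \<open>r = t\<close>, \<open>w = c t\<close>, that is \<open>y = - ln t\<close>, \<open>z = c t - b\<^sub>1 ln t\<close>, defined for \<open>t > 0\<close>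
  (lemma \<open>geodesic_half_plane_line\<close>). They are inextensible because \<open>y\<close> tends to infinity as \<open>t\<close> tends to
  \<open>0\<close> (lemma \<open>inextensible_half_plane_line\<close>). The squared speed is the constant \<open>4 a\<^sub>1 + c\<^sup>2\<close>
  (lemma \<open>half_plane_metric_line_velocity\<close>), so for \<open>a\<^sub>1 < 0\<close> the slope \<open>c\<close> can be chosen to realise each
  of the three causal characters.\<close>

section \<open>Smoothness\<close>

text \<open>This family contains \<open>u\<close> as well as the components of the induced metric, and it is closed under
  partial derivatives; that closure is what makes the induction over the order of
  differentiability work.\<close>

definition exp_affine :: "real \<Rightarrow> real \<Rightarrow> real \<Rightarrow> real \<Rightarrow> real^2 \<Rightarrow> real" where
  "exp_affine A B C D p = A * exp (- 2 * p$1) + B * p$1 + C * p$2 + D"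

lemma has_derivative_exp_affine:
  "(exp_affine A B C D has_derivative
     (\<lambda>h. (- 2 * A * exp (- 2 * p$1) + B) * h$1 + C * h$2)) (at p)"
  unfolding exp_affine_def
  by (auto intro!: derivative_eq_intros bounded_linear_imp_has_derivative [OF bounded_linear_vec_nth]
      simp: algebra_simps)

lemma frechet_derivative_exp_affine:
  "frechet_derivative (exp_affine A B C D) (at p) =
     (\<lambda>h. (- 2 * A * exp (- 2 * p$1) + B) * h$1 + C * h$2)"
  by (rule frechet_derivative_at [OF has_derivative_exp_affine, symmetric])

lemma partial_deriv_exp_affine:
  "partial_deriv 1 (exp_affine A B C D) = exp_affine (- 2 * A) 0 0 B"
  "partial_deriv 2 (exp_affine A B C D) = exp_affine 0 0 0 C"
  by (simp_all add: fun_eq_iff partial_deriv_def frechet_derivative_exp_affine exp_affine_def axis_def)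

lemma Ck_on_exp_affine: "Ck_on k (exp_affine A B C D) S"
proof (induction k arbitrary: A B C D)
  case 0
  show ?case
    by (auto simp: exp_affine_def intro!: continuous_intros)
next
  case (Suc k)
  have "exp_affine A B C D differentiable (at p)" for p
    using has_derivative_exp_affine by (rule differentiableI)
  with Suc show ?case
    by (simp add: forall_2 partial_deriv_exp_affine)
qed

lemma smooth_fun_on_exp_affine: "smooth_fun_on (exp_affine A B C D) S"
  by (simp add: smooth_fun_on_def Ck_on_exp_affine)

section \<open>The induced metric\<close>

lemma has_derivative_graph_map:
  assumes "(u has_derivative u') (at p)"
  shows "(graph_map u has_derivative (\<lambda>h. vector [u' h, h$1, h$2])) (at p)"
proof -
  have basis: "vector [a, b, c] = a *\<^sub>R axis 1 1 + b *\<^sub>R axis 2 1 + c *\<^sub>R (axis 3 1 :: real^3)"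
    for a b c :: real
    by (simp add: vec_eq_iff forall_3 axis_def)
  show ?thesis
    unfolding graph_map_def [abs_def] basis
    by (auto intro!: derivative_eq_intros assms
        bounded_linear_imp_has_derivative [OF bounded_linear_vec_nth])
qed

text \<open>The pullback under \<open>r = exp (- y)\<close>, \<open>w = z - b y\<close> of the flat metric \<open>4 a dr\<^sup>2 + dw\<^sup>2\<close> on the
  half-plane \<open>r > 0\<close>.\<close>

definition half_plane_metric :: "real \<Rightarrow> real \<Rightarrow> 2 metric_field" where
  "half_plane_metric a b p v w =
     4 * a * exp (- 2 * p$1) * v$1 * w$1 + (v$2 - b * v$1) * (w$2 - b * w$1)"

lemma pullback_graph_exp_affine:
  "pullback_metric (graph_map (exp_affine a (- (b\<^sup>2 / 2)) b d)) L3_metric = half_plane_metric a b"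
  by (simp add: fun_eq_iff pullback_metric_def L3_metric_def half_plane_metric_def
      frechet_derivative_at [OF has_derivative_graph_map [OF has_derivative_exp_affine], symmetric])
    (simp add: algebra_simps power2_eq_square)

lemma metric_comp_half_plane_metric:
  "metric_comp (half_plane_metric a b) 1 1 = exp_affine (4 * a) 0 0 (b\<^sup>2)"
  "metric_comp (half_plane_metric a b) 1 2 = exp_affine 0 0 0 (- b)"
  "metric_comp (half_plane_metric a b) 2 1 = exp_affine 0 0 0 (- b)"
  "metric_comp (half_plane_metric a b) 2 2 = exp_affine 0 0 0 1"
  by (simp_all add: fun_eq_iff metric_comp_def half_plane_metric_def exp_affine_def axis_def
      power2_eq_square)

lemma smooth_sym_tensor_half_plane_metric: "smooth_sym_tensor_on S (half_plane_metric a b)"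
proof -
  have "bilinear (half_plane_metric a b p)" for p
    by (auto simp: bilinear_def half_plane_metric_def algebra_simps intro!: linearI)
  moreover have "half_plane_metric a b p v w = half_plane_metric a b p w v" for p v w
    by (simp add: half_plane_metric_def)
  moreover have "smooth_fun_on (metric_comp (half_plane_metric a b) i j) S" for i j
    using exhaust_2 [of i] exhaust_2 [of j]
    by (auto simp: metric_comp_half_plane_metric smooth_fun_on_exp_affine)
  ultimately show ?thesis
    unfolding smooth_sym_tensor_on_def by blast
qed

lemma riemannian_half_plane_metric:
  assumes "a > 0"
  shows "riemannian_on S (half_plane_metric a b)"
proof -
  have "half_plane_metric a b p v v > 0" if "v \<noteq> 0" for p v
  proof (cases "v$1 = 0")
    case True
    with that have "v$2 \<noteq> 0"
      by (auto simp: vec_eq_iff forall_2)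
    with True show ?thesis
      by (simp add: half_plane_metric_def flip: power2_eq_square)
  next
    case False
    then have "4 * a * exp (- 2 * p$1) * (v$1)\<^sup>2 > 0"
      using assms by simp
    then have "4 * a * exp (- 2 * p$1) * (v$1)\<^sup>2 + (v$2 - b * v$1)\<^sup>2 > 0"
      by (rule add_pos_nonneg) simp
    then show ?thesis
      by (simp add: half_plane_metric_def power2_eq_square mult.assoc)
  qed
  then show ?thesis
    by (simp add: riemannian_on_def smooth_sym_tensor_half_plane_metric)
qed

lemma lorentzian_half_plane_metric:
  assumes "a < 0"
  shows "lorentzian_on S (half_plane_metric a b)"
proof -
  have "\<exists>e f. half_plane_metric a b p e e = -1 \<and> half_plane_metric a b p f f = 1 \<and>
      half_plane_metric a b p e f = 0" for p
  proof (intro exI conjI)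
    \<comment> \<open>The normalised coordinate vectors of \<open>r\<close> (up to sign) and of \<open>w\<close>.\<close>
    let ?s = "exp (p$1) / (2 * sqrt (- a))"
    let ?e = "vector [?s, b * ?s] :: real^2" and ?f = "vector [0, 1] :: real^2"
    have "exp (- 2 * p$1) * (exp (p$1))\<^sup>2 = 1"
      by (simp flip: exp_double exp_add)
    then show "half_plane_metric a b p ?e ?e = -1"
      using assms by (simp add: half_plane_metric_def field_simps power2_eq_square)
    show "half_plane_metric a b p ?f ?f = 1" "half_plane_metric a b p ?e ?f = 0"
      by (simp_all add: half_plane_metric_def)
  qed
  then show ?thesis
    by (simp add: lorentzian_on_def smooth_sym_tensor_half_plane_metric)
qed

section \<open>Its Christoffel symbols\<close>

lemma matrix_inv_eqI:
  fixes A :: "'a::semiring_1^'n^'m"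
  assumes "A ** B = mat 1" "B ** A = mat 1"
  shows "matrix_inv A = B"
proof -
  have inv: "A ** matrix_inv A = mat 1 \<and> matrix_inv A ** A = mat 1"
    unfolding matrix_inv_def by (rule someI [of _ B]) (use assms in blast)
  then have "matrix_inv A = matrix_inv A ** (A ** B)"
    using assms by simp
  also have "\<dots> = B"
    using inv by (simp add: matrix_mul_assoc)
  finally show ?thesis .
qed

lemma matrix_inv_half_plane_metric:
  fixes p :: "real^2"
  assumes "a \<noteq> 0"
  defines "E \<equiv> 4 * a * exp (- 2 * p$1)"
  shows "matrix_inv (\<chi> r s. metric_comp (half_plane_metric a b) r s p) =
    vector [vector [1 / E, b / E], vector [b / E, 1 + b\<^sup>2 / E]]"
proof (rule matrix_inv_eqI)
  have "E \<noteq> 0"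
    using assms by simp
  have comps: "exp_affine (4 * a) 0 0 (b\<^sup>2) p = E + b\<^sup>2" "\<And>D. exp_affine 0 0 0 D p = D"
    by (simp_all add: exp_affine_def E_def)
  let ?G = "(\<chi> r s. metric_comp (half_plane_metric a b) r s p) :: real^2^2"
  let ?H = "vector [vector [1 / E, b / E], vector [b / E, 1 + b\<^sup>2 / E]] :: real^2^2"
  show "?G ** ?H = mat 1" "?H ** ?G = mat 1"
    using \<open>E \<noteq> 0\<close>
    by (simp_all add: vec_eq_iff forall_2 matrix_matrix_mult_def mat_def sum_2
        metric_comp_half_plane_metric comps)
      (simp_all add: field_simps power2_eq_square)
qed

text \<open>Only \<open>\<partial>\<^sub>y g\<^sub>y\<^sub>y\<close> is nonzero, so the only surviving symbols have both lower indices equal to \<open>y\<close>;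
  the geodesic equations are therefore \<open>y'' = (y')\<^sup>2\<close> and \<open>z'' = b (y')\<^sup>2\<close>.\<close>

lemma christoffel_half_plane_metric:
  assumes "a \<noteq> 0"
  shows "christoffel (half_plane_metric a b) 1 i j p = (if i = 1 \<and> j = 1 then - 1 else 0)"
    and "christoffel (half_plane_metric a b) 2 i j p = (if i = 1 \<and> j = 1 then - b else 0)"
  using assms exhaust_2 [of i] exhaust_2 [of j]
  by (auto simp: christoffel_def matrix_inv_half_plane_metric sum_2 metric_comp_half_plane_metric
      partial_deriv_exp_affine exp_affine_def)

section \<open>Incomplete lines\<close>

definition half_plane_line :: "real \<Rightarrow> real \<Rightarrow> real \<Rightarrow> real^2" where
  "half_plane_line b c t = vector [- ln t, c * t - b * ln t]"

lemma has_vector_derivative_vector_2: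
  assumes "(f has_real_derivative f') (at t)" "(g has_real_derivative g') (at t)"
  shows "((\<lambda>t. vector [f t, g t] :: real^2) has_vector_derivative vector [f', g']) (at t)"
proof -
  have basis: "vector [a, b] = a *\<^sub>R axis 1 1 + b *\<^sub>R (axis 2 1 :: real^2)" for a b :: real
    by (simp add: vec_eq_iff forall_2 axis_def)
  show ?thesis
    unfolding basis
    by (auto intro!: derivative_eq_intros assms)
qed

lemma has_vector_derivative_half_plane_line:
  assumes "t > 0"
  shows "(half_plane_line b c has_vector_derivative vector [- 1 / t, c - b / t]) (at t)"
  unfolding half_plane_line_def [abs_def] using assms
  by (intro has_vector_derivative_vector_2) (auto intro!: derivative_eq_intros)

lemma geodesic_half_plane_line:
  assumes "a \<noteq> 0"
  shows "geodesic_on UNIV (half_plane_metric a b) {0<..} (half_plane_line b c)"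
proof -
  define v where "v t = (vector [- 1 / t, c - b / t] :: real^2)" for t
  define v' where "v' t = (vector [1 / t\<^sup>2, b / t\<^sup>2] :: real^2)" for t
  have "(v has_vector_derivative v' t) (at t)" if "t > 0" for t
    unfolding v_def [abs_def] v'_def using that
    by (intro has_vector_derivative_vector_2)
      (auto intro!: derivative_eq_intros simp: power2_eq_square)
  moreover have "v' t $ k + (\<Sum>i\<in>UNIV. \<Sum>j\<in>UNIV.
      christoffel (half_plane_metric a b) k i j (half_plane_line b c t) * v t $ i * v t $ j) = 0" for t k
    using exhaust_2 [of k] assms
    by (auto simp: v_def v'_def sum_2 christoffel_half_plane_metric power2_eq_square)
  moreover have "(half_plane_line b c has_vector_derivative v t) (at t)" if "t > 0" for t
    using that has_vector_derivative_half_plane_line by (simp add: v_def)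
  moreover have "is_interval {0::real<..}"
    by (simp add: is_interval_convex_1)
  ultimately show ?thesis
    unfolding geodesic_on_def
    by (intro conjI exI [where x = v] exI [where x = v'] ballI allI) auto
qed

lemma inextensible_half_plane_line:
  assumes "a \<noteq> 0"
  shows "inextensible_geodesic UNIV (half_plane_metric a b) {0<..} (half_plane_line b c)"
  unfolding inextensible_geodesic_def
proof (intro conjI allI impI geodesic_half_plane_line assms)
  fix J \<delta>
  assume asm: "geodesic_on UNIV (half_plane_metric a b) J \<delta> \<and> {0<..} \<subseteq> J \<and>
    (\<forall>t\<in>{0<..}. \<delta> t = half_plane_line b c t)"
  show "J = {0<..}"
  proof (rule ccontr)
    assume "J \<noteq> {0<..}"
    then obtain s where "s \<in> J" "s \<le> 0"
      using asm by (meson greaterThan_iff linorder_not_less subsetI subset_antisym)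
    moreover have "1 \<in> J"
      using asm by (meson greaterThan_iff subsetD zero_less_one)
    moreover have "is_interval J"
      using asm by (simp add: geodesic_on_def)
    ultimately have "0 \<in> J"
      by (meson is_interval_1 zero_le_one)
    \<comment> \<open>So \<open>y\<close> would have a finite limit at \<open>0\<close>, whereas \<open>- ln t\<close> is unbounded there.\<close>
    then obtain d where "(\<delta> has_vector_derivative d) (at 0)"
      using asm unfolding geodesic_on_def by blast
    then have "isCont \<delta> 0"
      by (rule has_vector_derivative_continuous)
    then have "isCont (\<lambda>t. \<delta> t $ 1) 0"
      by (intro continuous_intros)
    then have "((\<lambda>t. \<delta> t $ 1) \<longlongrightarrow> \<delta> 0 $ 1) (at_right 0)"
      unfolding isCont_def by (rule tendsto_mono [OF at_le, rotated]) simp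
    moreover have "\<forall>\<^sub>F t in at_right 0. \<delta> t $ 1 = - ln t"
      using asm by (auto simp: half_plane_line_def eventually_at_right_less
          intro!: eventually_at_rightI [of 0 1])
    ultimately have "((\<lambda>t::real. - ln t) \<longlongrightarrow> \<delta> 0 $ 1) (at_right 0)"
      by (simp cong: tendsto_cong)
    moreover have "filterlim (\<lambda>t::real. - ln t) at_infinity (at_right 0)"
      by (intro filterlim_at_top_imp_at_infinity)
        (simp add: filterlim_uminus_at_bot [symmetric] ln_at_0)
    ultimately show False
      using not_tendsto_and_filterlim_at_infinity trivial_limit_at_right_real by blast
  qed
qed

lemma half_plane_metric_line_velocity:
  fixes a b c t :: real
  assumes "t > 0"
  defines "v \<equiv> vector_derivative (half_plane_line b c) (at t)"
  shows "half_plane_metric a b (half_plane_line b c t) v v = 4 * a + c\<^sup>2"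
    and "v \<noteq> 0"
proof -
  have v: "v = vector [- 1 / t, c - b / t]"
    unfolding v_def
    by (rule vector_derivative_at [OF has_vector_derivative_half_plane_line [OF assms(1)]])
  have "exp (2 * ln t) = t\<^sup>2"
    using assms(1) by (simp add: exp_double)
  then show "half_plane_metric a b (half_plane_line b c t) v v = 4 * a + c\<^sup>2"
    using assms(1)
    by (simp add: half_plane_metric_def v half_plane_line_def power2_eq_square)
  show "v \<noteq> 0"
    using assms(1) by (auto simp: v vec_eq_iff forall_2)
qed

text \<open>The three causal characters depend on a nonzero vector only through its square, which is
  constant along each line; leaving \<open>C\<close> open treats them all at once, and the condition that always holds
  gives plain geodesic incompleteness.\<close>

lemma not_complete_in_sense_half_plane_metric:
  assumes "a \<noteq> 0"
    and "\<And>p v. half_plane_metric a b p v v = 4 * a + c\<^sup>2 \<Longrightarrow> v \<noteq> 0 \<Longrightarrow> C (half_plane_metric a b) p v"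
  shows "\<not> complete_in_sense C UNIV (half_plane_metric a b)"
proof
  assume "complete_in_sense C UNIV (half_plane_metric a b)"
  moreover have "\<forall>t\<in>{0<..}. C (half_plane_metric a b) (half_plane_line b c t)
      (vector_derivative (half_plane_line b c) (at t))"
    using assms(2) half_plane_metric_line_velocity by auto
  ultimately have "{0::real<..} = UNIV"
    using inextensible_half_plane_line [OF assms(1)] unfolding complete_in_sense_def by blast
  then show False
    using greaterThan_iff [of 0 "0::real"] by blast
qed

section \<open>The graph\<close>

theorem corollary3p5:
  fixes a1 b1 b0 :: real
    and u :: "real^2 \<Rightarrow> real"
    and \<Omega> :: "(real^2) set"
  assumes "a1 \<noteq> 0"
    and "\<And>y z :: real. u (vector [y, z]) = a1 * exp (- 2 * y) - b1\<^sup>2 / 2 * y + b1 * z + b0"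
    and "open \<Omega>" and "connected \<Omega>" and "\<Omega> \<noteq> {}"
  shows "(a1 > 0 \<longrightarrow> spacelike_immersion_on (graph_map u) \<Omega>) \<and>
    (a1 < 0 \<longrightarrow> timelike_immersion_on (graph_map u) \<Omega>) \<and>
    (inextensible_domain u \<Omega> \<longrightarrow>
      \<Omega> = UNIV \<and>
      \<not> geodesically_complete \<Omega> (pullback_metric (graph_map u) L3_metric) \<and>
      (a1 < 0 \<longrightarrow>
        \<not> complete_in_sense spacelike_vec \<Omega> (pullback_metric (graph_map u) L3_metric) \<and>
        \<not> complete_in_sense timelike_vec \<Omega> (pullback_metric (graph_map u) L3_metric) \<and>
        \<not> complete_in_sense lightlike_vec \<Omega> (pullback_metric (graph_map u) L3_metric)))"
proof -
  have "u p = exp_affine a1 (- (b1\<^sup>2 / 2)) b1 b0 p" for p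
  proof -
    have "p = vector [p$1, p$2]"
      by (simp add: vec_eq_iff forall_2)
    then show ?thesis
      using assms(2) [of "p$1" "p$2"] by (simp add: exp_affine_def)
  qed
  then have u: "u = exp_affine a1 (- (b1\<^sup>2 / 2)) b1 b0"
    by blast
  let ?g = "half_plane_metric a1 b1"
  have g: "pullback_metric (graph_map u) L3_metric = ?g"
    by (simp add: u pullback_graph_exp_affine)
  have "graph_domain u UNIV"
    by (simp add: graph_domain_def connected_UNIV u smooth_fun_on_exp_affine)
  then have entire: "\<Omega> = UNIV" if "inextensible_domain u \<Omega>"
    using that unfolding inextensible_domain_def by blast
  have "\<not> complete_in_sense (\<lambda>_ _ _. True) UNIV ?g"
    using assms(1) by (rule not_complete_in_sense_half_plane_metric) simp
  then have incomplete: "\<not> geodesically_complete UNIV ?g"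
    unfolding complete_in_sense_def geodesically_complete_def by blast
  have lorentzian_incomplete: "\<not> complete_in_sense spacelike_vec UNIV ?g \<and>
      \<not> complete_in_sense timelike_vec UNIV ?g \<and> \<not> complete_in_sense lightlike_vec UNIV ?g"
    if "a1 < 0"
  proof (intro conjI)
    \<comment> \<open>The slopes make the squared speed \<open>4 a\<^sub>1 + c\<^sup>2\<close> equal to \<open>- 4 a\<^sub>1\<close>, \<open>4 a\<^sub>1\<close> and \<open>0\<close>.\<close>
    show "\<not> complete_in_sense spacelike_vec UNIV ?g"
      by (rule not_complete_in_sense_half_plane_metric [where c = "sqrt (- 8 * a1)"])
        (use that in \<open>auto simp: spacelike_vec_def\<close>)
    show "\<not> complete_in_sense timelike_vec UNIV ?g"
      by (rule not_complete_in_sense_half_plane_metric [where c = 0])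
        (use that in \<open>auto simp: timelike_vec_def\<close>)
    show "\<not> complete_in_sense lightlike_vec UNIV ?g"
      by (rule not_complete_in_sense_half_plane_metric [where c = "sqrt (- 4 * a1)"])
        (use that in \<open>auto simp: lightlike_vec_def\<close>)
  qed
  show ?thesis
    using entire incomplete lorentzian_incomplete
    by (auto simp: spacelike_immersion_on_def timelike_immersion_on_def g
        riemannian_half_plane_metric lorentzian_half_plane_metric)
qed

end
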